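(* Let $G$ be a non-compact, locally compact, second countable group and let $\Omega$ be a locally compact space on which $G$ acts properly and which admits a $G$-invariant, regular Borel measure $\mu$. If $L^\infty(\Omega)=L^\infty(\Omega,\mu)$ has a $G$-invariant mean, then $G$ is amenable.
   Context: A continuous action of a locally compact second countable group $G$ on a locally compact space $\Omega$ is proper if for all compact subsets $K,L\subset\Omega$ the set $\{g\in G: gK\cap L\neq\emptyset\}$ is relatively compact in $G$. A $G$-invariant mean on $L^\infty(\Omega)$ is a positive linear functional $M$ on $L^\infty(\Omega)$ with $M(1)=1$ which is invariant under the action of $G$ on $L^\infty(\Omega)$ induced by the action of $G$ on $\Omega$. The group $G$ is amenable if $L^\infty(G)$ has a $G$-invariant mean with respect to the action of $G$ on itself by left translation. *)

theory Defs
  imports "HOL-Analysis.Analysis"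
begin

text \<open>
  Topological groups are types of class \<open>topological_group_add\<close>. This class does not
  assume commutativity: \<open>g + h\<close> is the product, \<open>0\<close> the identity and \<open>- g\<close> the inverse of an
  arbitrary group.
\<close>

definition continuous_action ::
  "('g::topological_group_add \<Rightarrow> 'x::topological_space \<Rightarrow> 'x) \<Rightarrow> bool" where
  "continuous_action act \<longleftrightarrow>
     (\<forall>x. act 0 x = x) \<and>
     (\<forall>g h x. act (g + h) x = act g (act h x)) \<and>
     continuous_on UNIV (\<lambda>(g, x). act g x)"

definition proper_action ::
  "('g::topological_group_add \<Rightarrow> 'x::topological_space \<Rightarrow> 'x) \<Rightarrow> bool" where
  "proper_action act \<longleftrightarrow>
     continuous_action act \<and>
     (\<forall>K L. compact K \<longrightarrow> compact L \<longrightarrow> compact (closure {g. act g ` K \<inter> L \<noteq> {}}))"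

definition regular_borel_measure :: "'a::topological_space measure \<Rightarrow> bool" where
  "regular_borel_measure \<mu> \<longleftrightarrow>
     sets \<mu> = sets borel \<and>
     (\<forall>K. compact K \<longrightarrow> emeasure \<mu> K < \<infinity>) \<and>
     (\<forall>A\<in>sets borel. emeasure \<mu> A = (INF U\<in>{U. open U \<and> A \<subseteq> U}. emeasure \<mu> U)) \<and>
     (\<forall>U. open U \<longrightarrow> emeasure \<mu> U = (SUP K\<in>{K. compact K \<and> K \<subseteq> U}. emeasure \<mu> K))"

definition invariant_measure :: "('g \<Rightarrow> 'x::topological_space \<Rightarrow> 'x) \<Rightarrow> 'x measure \<Rightarrow> bool" where
  "invariant_measure act \<mu> \<longleftrightarrow> (\<forall>g. distr \<mu> borel (act g) = \<mu>)"

definition left_haar_measure :: "'g::topological_group_add measure \<Rightarrow> bool" where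
  "left_haar_measure \<nu> \<longleftrightarrow>
     regular_borel_measure \<nu> \<and> emeasure \<nu> UNIV \<noteq> 0 \<and> invariant_measure (+) \<nu>"

text \<open>
  The space \<open>L\<^sup>\<infinity>(\<mu>)\<close> is taken in the form that is usual for regular Borel measures on locally
  compact spaces which need not be \<open>\<sigma>\<close>-finite (Folland, A Course in Abstract Harmonic Analysis,
  Section 2.3): measurability and null sets are tested on Borel sets of finite measure.
  For \<open>\<sigma>\<close>-finite \<open>\<mu>\<close> this is ordinary measurability and ordinary equality almost everywhere.
\<close>

definition locally_ae :: "'a measure \<Rightarrow> ('a \<Rightarrow> bool) \<Rightarrow> bool" where
  "locally_ae \<mu> P \<longleftrightarrow>
     (\<forall>F\<in>sets \<mu>. emeasure \<mu> F < \<infinity> \<longrightarrow> (AE x in \<mu>. x \<in> F \<longrightarrow> P x))"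

definition locally_measurable :: "'a measure \<Rightarrow> ('a \<Rightarrow> real) \<Rightarrow> bool" where
  "locally_measurable \<mu> f \<longleftrightarrow>
     (\<forall>F\<in>sets \<mu>. emeasure \<mu> F < \<infinity> \<longrightarrow> f \<in> borel_measurable (restrict_space \<mu> F))"

text \<open>Representatives of the elements of the real space \<open>L\<^sup>\<infinity>(\<mu>)\<close>.\<close>

definition Linf :: "'a measure \<Rightarrow> ('a \<Rightarrow> real) set" where
  "Linf \<mu> = {f. locally_measurable \<mu> f \<and> (\<exists>c. locally_ae \<mu> (\<lambda>x. \<bar>f x\<bar> \<le> c))}"

text \<open>
  A functional on \<open>L\<^sup>\<infinity>(\<mu>)\<close> is given on representatives; the first clause says that it descends to
  classes modulo equality locally almost everywhere. Values outside \<open>Linf \<mu>\<close> are irrelevant.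
  The group acts on functions by \<open>(g \<cdot> f)(x) = f(g\<inverse> x)\<close>.
\<close>

definition invariant_mean ::
  "('g::group_add \<Rightarrow> 'x \<Rightarrow> 'x) \<Rightarrow> 'x measure \<Rightarrow> (('x \<Rightarrow> real) \<Rightarrow> real) \<Rightarrow> bool" where
  "invariant_mean act \<mu> M \<longleftrightarrow>
     (\<forall>f\<in>Linf \<mu>. \<forall>h\<in>Linf \<mu>. locally_ae \<mu> (\<lambda>x. f x = h x) \<longrightarrow> M f = M h) \<and>
     (\<forall>f\<in>Linf \<mu>. \<forall>h\<in>Linf \<mu>. M (\<lambda>x. f x + h x) = M f + M h) \<and>
     (\<forall>f\<in>Linf \<mu>. \<forall>c. M (\<lambda>x. c * f x) = c * M f) \<and>
     (\<forall>f\<in>Linf \<mu>. locally_ae \<mu> (\<lambda>x. 0 \<le> f x) \<longrightarrow> 0 \<le> M f) \<and>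
     M (\<lambda>x. 1) = 1 \<and>
     (\<forall>g. \<forall>f\<in>Linf \<mu>. M (\<lambda>x. f (act (- g) x)) = M f)"

text \<open>
  Amenability refers to \<open>L\<^sup>\<infinity>(G)\<close>, hence to a left Haar measure \<open>\<nu>\<close> of \<open>G\<close>. As \<open>\<nu>\<close> is unique up to a
  positive factor, the space \<open>Linf \<nu>\<close> and its null sets do not depend on the choice of \<open>\<nu>\<close>.
\<close>

definition amenable :: "'g::topological_group_add measure \<Rightarrow> bool" where
  "amenable \<nu> \<longleftrightarrow> (\<exists>M. invariant_mean (+) \<nu> M)"

end

theory Submission
  imports Defs
begin

text \<open>
  A mean on \<open>L\<^sup>\<infinity>(\<Omega>)\<close> is pulled back along a positive, unital, equivariant linear map
  \<open>\<Phi> : L\<^sup>\<infinity>(G) \<rightarrow> L\<^sup>\<infinity>(\<Omega>)\<close>. Such a map averages over windows: attach to each point \<open>x\<close>, up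
  to a locally null set, a Borel set \<open>W(x) \<subseteq> G\<close> of finite, positive Haar measure with \<open>W(hx) = h W(x)\<close>, and let \<open>\<Phi> f(x)\<close> be the
  mean value of \<open>f\<close> over \<open>W(x)\<close>. Left invariance of Haar measure gives equivariance
  (\<open>window_mean_equivariant\<close>), and then \<open>M \<circ> \<Phi>\<close> is an invariant mean on \<open>L\<^sup>\<infinity>(G)\<close>
  (\<open>amenable_via_windows\<close>).

  On the saturation \<open>GK\<close> of one compact set \<open>K\<close> there is an obvious choice: take a relatively compact
  open \<open>V \<supseteq> K\<close> and put \<open>W(x) = {g. g\<inverse>x \<in> V}\<close>. It is open and nonempty, hence of positive Haar
  measure, and properness makes it relatively compact, hence of finite measure.

  The difficulty is to do this on all of \<open>\<Omega>\<close> at once. The orbit space may fail to be paracompact, so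
  that a continuous Bruhat function is not at hand, and \<open>\<mu>\<close> need not be \<open>\<sigma>\<close>-finite. As only functions
  modulo locally null sets matter, a measurable decomposition suffices. Zorn's lemma gives a
  maximal family of compact sets with pairwise disjoint saturations, each charging every relatively
  open nonempty subset of itself. The last property passes to the saturations, so an open set of finite measure
  meets only countably many of them, which keeps everything locally measurable; by maximality the
  union of the saturations has locally null complement (\<open>exists_charged_decomposition\<close>).
\<close>

section \<open>Borel sets and regular measures on locally compact spaces\<close>

text \<open>
  The space \<open>\<Omega>\<close> may have no countable base. One second countable factor is enough for every open
  subset of a product to be a countable union of open rectangles.
\<close>

lemma open_in_sets_borel_pair:
  fixes S :: "('a::topological_space \<times> 'b::second_countable_topology) set"
  assumes "open S"
  shows "S \<in> sets (borel \<Otimes>\<^sub>M borel)"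
proof -
  obtain B :: "'b set set" where B: "countable B" "topological_basis B"
    using ex_countable_basis by blast
  \<comment> \<open>\<open>A b\<close> is the largest open set whose rectangle over \<open>b\<close> lies in \<open>S\<close>; the countable union runs over
    base sets \<open>b\<close> only.\<close>
  define A where "A b = \<Union>{V :: 'a set. open V \<and> V \<times> b \<subseteq> S}" for b
  have "S = (\<Union>b\<in>B. A b \<times> b)"
  proof
    show "S \<subseteq> (\<Union>b\<in>B. A b \<times> b)"
    proof
      fix z assume "z \<in> S"
      obtain x y where z: "z = (x, y)" by fastforce
      obtain V U where VU: "open V" "open U" "x \<in> V" "y \<in> U" "V \<times> U \<subseteq> S"
        using open_prod_elim[OF assms \<open>z \<in> S\<close>] unfolding z mem_Times_iff fst_conv snd_conv
        by metis
      obtain b where b: "b \<in> B" "y \<in> b" "b \<subseteq> U"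
        using topological_basisE[OF B(2) VU(2,4)] by metis
      have "x \<in> A b" unfolding A_def using VU b by blast
      then show "z \<in> (\<Union>b\<in>B. A b \<times> b)" using b z by blast
    qed
  qed (auto simp: A_def)
  moreover have "(\<Union>b\<in>B. A b \<times> b) \<in> sets (borel \<Otimes>\<^sub>M borel)"
  proof (rule sets.countable_UN''[OF B(1)])
    fix b assume "b \<in> B"
    have "open (A b)" unfolding A_def by blast
    then show "A b \<times> b \<in> sets (borel \<Otimes>\<^sub>M borel)"
      using topological_basis_open[OF B(2) \<open>b \<in> B\<close>] by (intro pair_measureI) auto
  qed
  ultimately show ?thesis by simp
qed

lemma compact_subset_open_subset_compact:
  fixes K :: "'a::topological_space set"
  assumes lc: "locally_compact_space (euclidean :: 'a topology)" and K: "compact K"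
  obtains V C where "open V" "compact C" "K \<subseteq> V" "V \<subseteq> C"
proof -
  have "\<exists>U C. open U \<and> compact C \<and> x \<in> U \<and> U \<subseteq> C" for x :: 'a
    using lc unfolding locally_compact_space_def by auto
  then obtain U C where UC: "\<And>x :: 'a. open (U x)" "\<And>x. compact (C x)" "\<And>x. x \<in> U x"
      "\<And>x. U x \<subseteq> C x"
    by metis
  obtain X where X: "X \<subseteq> K" "finite X" "K \<subseteq> (\<Union>x\<in>X. U x)"
  proof (rule compactE_image[OF K])
    show "K \<subseteq> (\<Union>x\<in>K. U x)" using UC(3) by blast
  qed (use UC(1) in auto)
  show ?thesis
  proof
    show "open (\<Union>x\<in>X. U x)" using UC(1) by blast
    show "compact (\<Union>x\<in>X. C x)" using UC(2) X(2) by (intro compact_UN) auto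
    show "K \<subseteq> (\<Union>x\<in>X. U x)" by fact
    show "(\<Union>x\<in>X. U x) \<subseteq> (\<Union>x\<in>X. C x)" using UC(4) by blast
  qed
qed

lemma regular_borel_measureD:
  assumes "regular_borel_measure \<mu>"
  shows "sets \<mu> = sets borel" "space \<mu> = UNIV"
    and "compact K \<Longrightarrow> emeasure \<mu> K < \<infinity>"
    and "A \<in> sets borel \<Longrightarrow> emeasure \<mu> A = (INF U\<in>{U. open U \<and> A \<subseteq> U}. emeasure \<mu> U)"
    and "open U \<Longrightarrow> emeasure \<mu> U = (SUP K\<in>{K. compact K \<and> K \<subseteq> U}. emeasure \<mu> K)"
  using assms sets_eq_imp_space_eq[of \<mu> borel] unfolding regular_borel_measure_def by auto

lemma regular_outer_open:
  assumes "regular_borel_measure \<mu>" "A \<in> sets borel" "emeasure \<mu> A < c"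
  obtains U where "open U" "A \<subseteq> U" "emeasure \<mu> U < c"
  using assms(3) regular_borel_measureD(4)[OF assms(1,2)] by (auto simp: INF_less_iff)

text \<open>
  Inner regularity is assumed on open sets only. Approximate an open \<open>V \<supseteq> A\<close> of finite measure from
  inside by a compact \<open>L\<close>, and \<open>V - A\<close> from outside by an open \<open>W\<close>, with \<open>W\<close> smaller in measure than
  \<open>L\<close>; then the compact set \<open>L - W\<close> lies in \<open>A\<close> and is not null.
\<close>

lemma regular_inner_compact:
  fixes \<mu> :: "'x::t2_space measure"
  assumes reg: "regular_borel_measure \<mu>" and A: "A \<in> sets borel"
    and fin: "emeasure \<mu> A < \<infinity>" and pos: "0 < emeasure \<mu> A"
  obtains K where "compact K" "K \<subseteq> A" "0 < emeasure \<mu> K"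
proof -
  note [simp] = regular_borel_measureD(1,2)[OF reg]
  obtain V where V: "open V" "A \<subseteq> V" "emeasure \<mu> V < \<infinity>"
    by (rule regular_outer_open[OF reg A fin])
  have Vs: "V \<in> sets borel" using V by simp
  have "emeasure \<mu> (V - A) < emeasure \<mu> V"
  proof -
    have "emeasure \<mu> V = emeasure \<mu> (V - A) + emeasure \<mu> A"
      using plus_emeasure[of "V - A" \<mu> A] V A Vs by (simp add: Un_absorb2 Int_commute[of _ A])
    moreover have "emeasure \<mu> (V - A) \<noteq> \<infinity>"
      using calculation V(3) by auto
    ultimately show ?thesis
      using pos ennreal_add_left_cancel_less[of "emeasure \<mu> (V - A)" 0 "emeasure \<mu> A"] by simp
  qed
  then obtain W where W: "open W" "V - A \<subseteq> W" "emeasure \<mu> W < emeasure \<mu> V"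
    by (rule regular_outer_open[OF reg sets.Diff[OF Vs A]])
  obtain L where L: "compact L" "L \<subseteq> V" "emeasure \<mu> W < emeasure \<mu> L"
    using W(3) regular_borel_measureD(5)[OF reg V(1)] by (auto simp: less_SUP_iff)
  have Ls: "L \<in> sets borel" using L borel_compact by auto
  have Ws: "W \<in> sets borel" using W by simp
  show ?thesis
  proof
    show "compact (L - W)" using L W by (simp add: compact_diff)
    show "L - W \<subseteq> A" using W L by blast
    show "0 < emeasure \<mu> (L - W)"
    proof (rule ccontr)
      assume "\<not> ?thesis"
      then have "emeasure \<mu> (L - W) = 0" by simp
      have "emeasure \<mu> L \<le> emeasure \<mu> (W \<union> (L - W))"
        using Ls Ws by (intro emeasure_mono) auto
      also have "\<dots> \<le> emeasure \<mu> W + emeasure \<mu> (L - W)"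
        using Ls Ws by (intro emeasure_subadditive) auto
      finally show False using L(3) \<open>emeasure \<mu> (L - W) = 0\<close> by simp
    qed
  qed
qed

definition fully_charged :: "'x::topological_space measure \<Rightarrow> 'x set \<Rightarrow> bool" where
  "fully_charged \<mu> A \<longleftrightarrow> (\<forall>U. open U \<longrightarrow> U \<inter> A \<noteq> {} \<longrightarrow> 0 < emeasure \<mu> (U \<inter> A))"

text \<open>
  The set \<open>L\<close> is the support of the restriction of \<open>\<mu>\<close> to \<open>K\<close>. The part \<open>W \<inter> K\<close> that is cut off is a
  possibly uncountable union of null sets; it is null because each compact subset of it is covered by
  finitely many of them.
\<close>

lemma compact_contains_fully_charged:
  fixes \<mu> :: "'x::t2_space measure"
  assumes reg: "regular_borel_measure \<mu>" and K: "compact K" and pos: "0 < emeasure \<mu> K"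
  obtains L where "compact L" "L \<subseteq> K" "L \<noteq> {}" "fully_charged \<mu> L"
proof -
  note [simp] = regular_borel_measureD(1,2)[OF reg]
  define W where "W = \<Union>{U. open U \<and> emeasure \<mu> (U \<inter> K) = 0}"
  have W: "open W" unfolding W_def by blast
  have Ks: "K \<in> sets borel" using K borel_compact by auto
  have null: "emeasure \<mu> (W \<inter> K) = 0"
  proof (rule ccontr)
    assume "\<not> ?thesis"
    then have "0 < emeasure \<mu> (W \<inter> K)" by (simp add: zero_less_iff_neq_zero)
    have "emeasure \<mu> (W \<inter> K) < \<infinity>"
      using regular_borel_measureD(3)[OF reg K] emeasure_mono[of "W \<inter> K" K \<mu>] Ks by auto
    then obtain C where C: "compact C" "C \<subseteq> W \<inter> K" "0 < emeasure \<mu> C"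
      using \<open>0 < emeasure \<mu> (W \<inter> K)\<close>
      by (rule regular_inner_compact[OF reg sets.Int[OF borel_open[OF W] Ks]])
    obtain D where D: "D \<subseteq> {U. open U \<and> emeasure \<mu> (U \<inter> K) = 0}" "finite D" "C \<subseteq> \<Union>D"
    proof (rule compactE[OF C(1)])
      show "C \<subseteq> \<Union>{U. open U \<and> emeasure \<mu> (U \<inter> K) = 0}" using C(2) unfolding W_def by blast
    qed auto
    have "emeasure \<mu> (\<Union>U\<in>D. U \<inter> K) = 0"
      using D Ks by (intro null_setsD1 null_sets_UN' countable_finite) (auto simp: null_sets_def)
    moreover have "emeasure \<mu> C \<le> emeasure \<mu> (\<Union>U\<in>D. U \<inter> K)"
      using C D Ks by (intro emeasure_mono sets.finite_UN) auto
    ultimately show False using C(3) by simp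
  qed
  have eq: "emeasure \<mu> (U \<inter> (K - W)) = emeasure \<mu> (U \<inter> K)" if "open U" for U
  proof -
    have "U \<inter> (K - W) = U \<inter> K - W \<inter> K" by blast
    then show ?thesis
      using null that W Ks by (simp add: emeasure_Diff_null_set null_sets_def)
  qed
  show ?thesis
  proof
    show "compact (K - W)" using K W by (simp add: compact_diff)
    show "K - W \<subseteq> K" by blast
    show "K - W \<noteq> {}"
      using eq[of UNIV] pos by (metis Int_UNIV_left emeasure_empty open_UNIV order_less_irrefl)
    show "fully_charged \<mu> (K - W)"
      unfolding fully_charged_def using eq
      by (auto simp: W_def zero_less_iff_neq_zero)
  qed
qed

section \<open>Actions\<close>

lemma continuous_actionD:
  assumes "continuous_action act"
  shows "act 0 x = x" "act (g + h) x = act g (act h x)" "act (- g) (act g x) = x"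
    "act g (act (- g) x) = x" "continuous_on UNIV (act g)"
proof -
  show 1: "act 0 x = x" "act (g + h) x = act g (act h x)" for x g h
    using assms unfolding continuous_action_def by auto
  show "act (- g) (act g x) = x" "act g (act (- g) x) = x"
    using 1(2)[of "- g" g] 1(2)[of g "- g"] by (simp_all add: 1(1))
  have "continuous_on UNIV ((\<lambda>(g, x). act g x) \<circ> Pair g)"
    using assms unfolding continuous_action_def
    by (intro continuous_on_compose continuous_intros) (auto intro: continuous_on_subset)
  then show "continuous_on UNIV (act g)" by (simp add: comp_def)
qed

lemma proper_actionD:
  assumes "proper_action act"
  shows "continuous_action act"
    and "compact K \<Longrightarrow> compact L \<Longrightarrow> compact (closure {g. act g ` K \<inter> L \<noteq> {}})"
  using assms unfolding proper_action_def by blast+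

lemma emeasure_translate:
  assumes "invariant_measure act \<mu>" "sets \<mu> = sets borel" "continuous_on UNIV (act g)"
    and "A \<in> sets borel"
  shows "emeasure \<mu> (act g -` A) = emeasure \<mu> A"
proof -
  have "act g \<in> measurable \<mu> borel"
    using borel_measurable_continuous_onI[OF assms(3)] measurable_cong_sets[OF assms(2)] by blast
  then have "emeasure (distr \<mu> borel (act g)) A = emeasure \<mu> (act g -` A)"
    using emeasure_distr[of "act g" \<mu> borel A] assms(4) sets_eq_imp_space_eq[OF assms(2)] by simp
  then show ?thesis using assms(1) unfolding invariant_measure_def by simp
qed

definition saturation :: "('g \<Rightarrow> 'x \<Rightarrow> 'x) \<Rightarrow> 'x set \<Rightarrow> 'x set" where
  "saturation act K = (\<Union>g. act g ` K)"

lemma mem_saturation_iff: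
  assumes "continuous_action act"
  shows "x \<in> saturation act K \<longleftrightarrow> (\<exists>g. act (- g) x \<in> K)"
proof
  assume "x \<in> saturation act K"
  then obtain g y where "y \<in> K" "x = act g y" unfolding saturation_def by auto
  then have "act (- g) x \<in> K" using continuous_actionD(3)[OF assms] by simp
  then show "\<exists>g. act (- g) x \<in> K" ..
next
  assume "\<exists>g. act (- g) x \<in> K"
  then obtain g where "act (- g) x \<in> K" ..
  then have "act g (act (- g) x) \<in> saturation act K" unfolding saturation_def by blast
  then show "x \<in> saturation act K" using continuous_actionD(4)[OF assms] by simp
qed

lemma saturation_invariant:
  assumes "continuous_action act"
  shows "act g x \<in> saturation act K \<longleftrightarrow> x \<in> saturation act K"
proof -
  have "act g x \<in> saturation act K" if x: "x \<in> saturation act K" for g x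
  proof -
    obtain h y where "y \<in> K" "x = act h y" using x unfolding saturation_def by auto
    then have "act g x = act (g + h) y" using continuous_actionD(2)[OF assms] by simp
    then show ?thesis using \<open>y \<in> K\<close> unfolding saturation_def by blast
  qed
  from this[of x g] this[of "act g x" "- g"] show ?thesis
    unfolding continuous_actionD(3)[OF assms] by blast
qed

lemma subset_saturation: "continuous_action act \<Longrightarrow> K \<subseteq> saturation act K"
  using mem_saturation_iff[of act _ K] continuous_actionD(1)[of act] by (metis minus_zero subsetI)

text \<open>
  The \<open>\<sigma>\<close>-compactness of \<open>G\<close> makes the saturation of a compact set a countable union of compact sets,
  hence Borel, and makes Haar measure \<open>\<sigma>\<close>-finite.
\<close>

lemma sigma_compact_UNIV:
  assumes "locally_compact_space (euclidean :: 'g::second_countable_topology topology)"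
  obtains \<C> :: "'g::second_countable_topology set set"
  where "countable \<C>" "\<And>C. C \<in> \<C> \<Longrightarrow> compact C" "\<Union>\<C> = UNIV"
proof -
  have "\<exists>U K. open U \<and> compact K \<and> x \<in> U \<and> U \<subseteq> K" for x :: 'g
    using assms unfolding locally_compact_space_def by auto
  then obtain U K where UK: "\<And>x :: 'g. open (U x)" "\<And>x. compact (K x)" "\<And>x. x \<in> U x"
      "\<And>x. U x \<subseteq> K x"
    by metis
  obtain F where F: "F \<subseteq> range U" "countable F" "\<Union>F = \<Union>(range U)"
    using Lindelof[of "range U"] UK(1) by blast
  obtain X where X: "countable X" "F = U ` X"
    using F(1,2) by (meson countable_subset_image)
  show ?thesis
  proof
    show "countable (K ` X)" using X by simp
    show "\<And>C. C \<in> K ` X \<Longrightarrow> compact C" using UK by auto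
    have "\<Union>F = UNIV" unfolding F(3) using UK(3) by blast
    then show "\<Union>(K ` X) = UNIV" using UK(4) X(2) by blast
  qed
qed

lemma saturation_borel:
  fixes act :: "'g::{topological_group_add, second_countable_topology} \<Rightarrow> 'x::t2_space \<Rightarrow> 'x"
  assumes lc: "locally_compact_space (euclidean :: 'g topology)"
    and act: "continuous_action act" and K: "compact K"
  shows "saturation act K \<in> sets borel"
proof -
  obtain \<C> :: "'g set set" where \<C>: "countable \<C>" "\<And>C. C \<in> \<C> \<Longrightarrow> compact C" "\<Union>\<C> = UNIV"
    using sigma_compact_UNIV[OF lc] by blast
  have "saturation act K = (\<Union>C\<in>\<C>. (\<lambda>(g, x). act g x) ` (C \<times> K))"
  proof -
    have "saturation act K = (\<Union>C\<in>\<C>. \<Union>g\<in>C. act g ` K)"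
      unfolding saturation_def \<C>(3)[symmetric] by blast
    then show ?thesis by auto
  qed
  moreover have "(\<lambda>(g, x). act g x) ` (C \<times> K) \<in> sets borel" if "C \<in> \<C>" for C
  proof -
    have "continuous_on (C \<times> K) (\<lambda>(g, x). act g x)"
      using act unfolding continuous_action_def by (auto intro: continuous_on_subset)
    then show ?thesis
      using \<C>(2)[OF that] K by (intro borel_compact compact_continuous_image compact_Times)
  qed
  ultimately show ?thesis using \<C>(1) by (simp add: sets.countable_UN'')
qed

text \<open>
  An open set that meets \<open>gK\<close> is a translate by \<open>g\<close> of an open set that meets \<open>K\<close>, and \<open>\<mu>\<close> is invariant.
\<close>

lemma fully_charged_saturation:
  fixes act :: "'g::{topological_group_add, second_countable_topology} \<Rightarrow> 'x::t2_space \<Rightarrow> 'x"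
  assumes lc: "locally_compact_space (euclidean :: 'g topology)"
    and act: "continuous_action act" and reg: "regular_borel_measure \<mu>"
    and inv: "invariant_measure act \<mu>" and K: "compact K" "fully_charged \<mu> K"
  shows "fully_charged \<mu> (saturation act K)"
  unfolding fully_charged_def
proof (intro allI impI)
  fix U :: "'x set" assume U: "open U" "U \<inter> saturation act K \<noteq> {}"
  note [simp] = regular_borel_measureD(1,2)[OF reg]
  note sat = saturation_borel[OF lc act K(1)]
  obtain g x where x: "x \<in> K" "act g x \<in> U" using U(2) unfolding saturation_def by auto
  have "open (act g -` U)"
    using continuous_actionD(5)[OF act] U(1) by (simp add: open_vimage)
  then have "0 < emeasure \<mu> (act g -` U \<inter> K)"
    using K(2) x unfolding fully_charged_def by blast
  also have "\<dots> \<le> emeasure \<mu> (act g -` (U \<inter> saturation act K))"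
  proof (rule emeasure_mono)
    show "act g -` U \<inter> K \<subseteq> act g -` (U \<inter> saturation act K)"
      unfolding saturation_def by blast
    show "act g -` (U \<inter> saturation act K) \<in> sets \<mu>"
      using measurable_sets[OF borel_measurable_continuous_onI[OF continuous_actionD(5)[OF act]],
          of "U \<inter> saturation act K" g] sat U(1)
      by simp
  qed
  also have "\<dots> = emeasure \<mu> (U \<inter> saturation act K)"
    using sat U(1) by (intro emeasure_translate[OF inv _ continuous_actionD(5)[OF act]]) auto
  finally show "0 < emeasure \<mu> (U \<inter> saturation act K)" .
qed

section \<open>Decomposition into saturations of compact sets\<close>

lemma countable_disjoint_positive:
  fixes A :: "'i \<Rightarrow> 'x set"
  assumes disj: "disjoint_family_on A I" and meas: "\<And>i. i \<in> I \<Longrightarrow> A i \<in> sets M"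
    and U: "U \<in> sets M" "emeasure M U < \<infinity>"
    and pos: "\<And>i. i \<in> I \<Longrightarrow> 0 < emeasure M (U \<inter> A i)"
  shows "countable I"
proof -
  have fm: "U \<inter> A i \<in> fmeasurable M" if "i \<in> I" for i
    using meas[OF that] U fmeasurable.Int[of U M "A i"]
    by (metis fmeasurableI fmeasurable_Int_fmeasurable)
  have "(\<lambda>i. measure M (U \<inter> A i)) summable_on I"
  proof (rule nonneg_bdd_above_summable_on)
    show "bdd_above (sum (\<lambda>i. measure M (U \<inter> A i)) ` {F. F \<subseteq> I \<and> finite F})"
    proof (rule bdd_aboveI2)
      fix F assume F: "F \<in> {F. F \<subseteq> I \<and> finite F}"
      have "(\<Sum>i\<in>F. measure M (U \<inter> A i)) = measure M (\<Union>i\<in>F. U \<inter> A i)"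
        using F disj fm
        by (intro measure_finite_Union[symmetric])
          (auto simp: disjoint_family_on_def fmeasurableD2)
      also have "\<dots> \<le> measure M U"
        using F U fm by (intro measure_mono_fmeasurable sets.finite_UN) (auto intro: fmeasurableI)
      finally show "(\<Sum>i\<in>F. measure M (U \<inter> A i)) \<le> measure M U" .
    qed
  qed simp
  then have "countable {i \<in> I. measure M (U \<inter> A i) \<noteq> 0}"
    by (rule summable_countable_real)
  moreover have "{i \<in> I. measure M (U \<inter> A i) \<noteq> 0} = I"
  proof -
    have "measure M (U \<inter> A i) \<noteq> 0" if "i \<in> I" for i
      using pos[OF that] emeasure_eq_measure2[OF fm[OF that]] by auto
    then show ?thesis by blast
  qed
  ultimately show ?thesis by simp
qed

text \<open>
  Full charge is what makes the family locally countable: the members that meet an open set \<open>U\<close> of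
  finite measure cut it in disjoint sets of positive measure. Disjoint saturations of arbitrary
  compact sets could meet \<open>U\<close> in uncountably many null sets with a union that is not null, or not
  Borel.
\<close>

lemma exists_charged_decomposition:
  fixes act :: "'g::{topological_group_add, second_countable_topology} \<Rightarrow> 'x::t2_space \<Rightarrow> 'x"
  assumes lc: "locally_compact_space (euclidean :: 'g topology)"
    and act: "continuous_action act" and reg: "regular_borel_measure \<mu>"
    and inv: "invariant_measure act \<mu>"
  obtains \<K> where "\<And>K. K \<in> \<K> \<Longrightarrow> compact K"
    and "disjoint_family_on (saturation act) \<K>"
    and "\<And>U. open U \<Longrightarrow> emeasure \<mu> U < \<infinity> \<Longrightarrow>
           countable {K \<in> \<K>. saturation act K \<inter> U \<noteq> {}}"
    and "\<And>U. open U \<Longrightarrow> emeasure \<mu> U < \<infinity> \<Longrightarrow>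
           U - (\<Union>K\<in>\<K>. saturation act K) \<in> null_sets \<mu>"
proof -
  note [simp] = regular_borel_measureD(1,2)[OF reg]
  let ?s = "saturation act"
  define P where "P = {K. compact K \<and> K \<noteq> {} \<and> fully_charged \<mu> K}"
  let ?A = "{\<K>. \<K> \<subseteq> P \<and> pairwise (\<lambda>K L. ?s K \<inter> ?s L = {}) \<K>}"
  have "\<exists>\<K>\<in>?A. \<forall>\<L>\<in>?A. \<K> \<subseteq> \<L> \<longrightarrow> \<L> = \<K>"
  proof (rule subset_Zorn')
    fix C assume "subset.chain ?A C"
    then have C: "C \<subseteq> ?A" "chain\<^sub>\<subseteq> C"
      by (auto simp: subset_chain_def chain_subset_def)
    then show "\<Union>C \<in> ?A"
      using pairwise_chain_Union[of C "\<lambda>K L. ?s K \<inter> ?s L = {}"] by blast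
  qed
  then obtain \<K> where \<K>: "\<K> \<in> ?A" and "\<forall>\<L>\<in>?A. \<K> \<subseteq> \<L> \<longrightarrow> \<L> = \<K>" ..
  then have max: "\<L> = \<K>"
    if "\<L> \<subseteq> P" "pairwise (\<lambda>K L. ?s K \<inter> ?s L = {}) \<L>" "\<K> \<subseteq> \<L>" for \<L>
    using that by simp
  have \<K>P: "\<K> \<subseteq> P" and pw: "pairwise (\<lambda>K L. ?s K \<inter> ?s L = {}) \<K>"
    using \<K> by simp_all
  have disj: "disjoint_family_on ?s \<K>"
    using pw unfolding disjoint_family_on_def pairwise_def by blast
  have cpt: "compact K" if "K \<in> \<K>" for K using that \<K>P unfolding P_def by blast
  have meas: "?s K \<in> sets \<mu>" if "K \<in> \<K>" for K
    using saturation_borel[OF lc act cpt[OF that]] by simp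
  have count: "countable {K \<in> \<K>. ?s K \<inter> U \<noteq> {}}" if U: "open U" "emeasure \<mu> U < \<infinity>" for U
  proof (rule countable_disjoint_positive)
    show "disjoint_family_on ?s {K \<in> \<K>. ?s K \<inter> U \<noteq> {}}"
      using disj by (rule disjoint_family_on_mono[rotated]) auto
    fix K assume K: "K \<in> {K \<in> \<K>. ?s K \<inter> U \<noteq> {}}"
    then have "fully_charged \<mu> (?s K)"
      using \<K>P unfolding P_def by (intro fully_charged_saturation[OF lc act reg inv]) auto
    then show "0 < emeasure \<mu> (U \<inter> ?s K)" using K U unfolding fully_charged_def by blast
  qed (use meas U in auto)
  have null: "U - (\<Union>K\<in>\<K>. ?s K) \<in> null_sets \<mu>" if U: "open U" "emeasure \<mu> U < \<infinity>" for U
  proof -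
    let ?N = "U - (\<Union>K\<in>\<K>. ?s K)"
    have eq: "?N = U - (\<Union>K\<in>{K \<in> \<K>. ?s K \<inter> U \<noteq> {}}. ?s K)" by blast
    have "(\<Union>K\<in>{K \<in> \<K>. ?s K \<inter> U \<noteq> {}}. ?s K) \<in> sets borel"
      using count[OF U] meas by (intro sets.countable_UN'') auto
    then have N: "?N \<in> sets borel" unfolding eq by (rule sets.Diff[OF borel_open[OF U(1)]])
    have "emeasure \<mu> ?N = 0"
    proof (rule ccontr)
      assume "emeasure \<mu> ?N \<noteq> 0"
      then have pos: "0 < emeasure \<mu> ?N" by (simp add: zero_less_iff_neq_zero)
      have "emeasure \<mu> ?N \<le> emeasure \<mu> U" using U(1) by (intro emeasure_mono) auto
      then have fin: "emeasure \<mu> ?N < \<infinity>" using U(2) by (rule le_less_trans)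
      obtain F where F: "compact F" "F \<subseteq> ?N" "0 < emeasure \<mu> F"
        by (rule regular_inner_compact[OF reg N fin pos])
      obtain L where L: "compact L" "L \<subseteq> F" "L \<noteq> {}" "fully_charged \<mu> L"
        by (rule compact_contains_fully_charged[OF reg F(1,3)])
      \<comment> \<open>The complement of the union is invariant, so it contains the whole saturation of \<open>L\<close>, and \<open>L\<close>
        could be added to the maximal family.\<close>
      have new: "?s L \<inter> ?s K = {}" if "K \<in> \<K>" for K
      proof -
        have "x \<notin> ?s K" if "x \<in> ?s L" for x
        proof -
          obtain g where "act (- g) x \<in> L" using \<open>x \<in> ?s L\<close> unfolding mem_saturation_iff[OF act] ..
          then have "act (- g) x \<notin> ?s K" using L(2) F(2) \<open>K \<in> \<K>\<close> by blast
          then show ?thesis using saturation_invariant[OF act, of "- g" x K] by blast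
        qed
        then show ?thesis by blast
      qed
      have "insert L \<K> = \<K>"
        using new pw \<K>P L by (intro max) (auto simp: pairwise_insert P_def)
      then have "L \<in> \<K>" by blast
      then show False using new[of L] L(3) subset_saturation[OF act, of L] by blast
    qed
    then show ?thesis using N by (simp add: null_sets_def)
  qed
  show ?thesis using that[OF cpt disj count null] .
qed

section \<open>Haar measure and \<open>\<sigma>\<close>-finiteness\<close>

lemma left_haar_measureD:
  assumes "left_haar_measure \<nu>"
  shows "regular_borel_measure \<nu>" "emeasure \<nu> UNIV \<noteq> 0" "invariant_measure (+) \<nu>"
  using assms unfolding left_haar_measure_def by auto

text \<open>If \<open>U\<close> were null, countably many of its null translates would cover \<open>G\<close>, by Lindelof's theorem.\<close>

lemma haar_open_positive:
  fixes \<nu> :: "'g::{topological_group_add, second_countable_topology} measure"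
  assumes haar: "left_haar_measure \<nu>" and U: "open U" "U \<noteq> {}"
  shows "0 < emeasure \<nu> U"
proof (rule ccontr)
  assume "\<not> ?thesis"
  then have 0: "emeasure \<nu> U = 0" by simp
  note [simp] = regular_borel_measureD(1,2)[OF left_haar_measureD(1)[OF haar]]
  obtain u where u: "u \<in> U" using U by blast
  define T where "T h = (+) h -` U" for h
  have cont: "continuous_on UNIV ((+) h)" for h :: 'g by (intro continuous_intros)
  have T: "open (T h)" for h
    unfolding T_def using cont U(1) by (simp add: open_vimage)
  have Tnull: "T h \<in> null_sets \<nu>" for h
    using emeasure_translate[OF left_haar_measureD(3)[OF haar] _ cont, of U h] 0 T[of h] U(1)
    by (simp add: T_def null_sets_def)
  obtain F where F: "F \<subseteq> range T" "countable F" "\<Union>F = \<Union>(range T)"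
    using Lindelof[of "range T"] T by blast
  have "g \<in> T (u - g)" for g using u by (simp add: T_def)
  then have "\<Union>F = UNIV" unfolding F(3) by blast
  moreover have "(\<Union>A\<in>F. A) \<in> null_sets \<nu>"
    using F Tnull by (intro null_sets_UN') auto
  ultimately show False using left_haar_measureD(2)[OF haar] by auto
qed

lemma sigma_compact_imp_sigma_finite:
  fixes \<nu> :: "'g::{t2_space, second_countable_topology} measure"
  assumes "locally_compact_space (euclidean :: 'g topology)" "regular_borel_measure \<nu>"
  shows "sigma_finite_measure \<nu>"
proof -
  note [simp] = regular_borel_measureD(1,2)[OF assms(2)]
  obtain \<C> :: "'g set set" where "countable \<C>" "\<And>C. C \<in> \<C> \<Longrightarrow> compact C" "\<Union>\<C> = UNIV"
    using sigma_compact_UNIV[OF assms(1)] by blast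
  then show ?thesis
    using regular_borel_measureD(3)[OF assms(2)] borel_compact
    by (intro sigma_finite_measure.intro) (auto simp: less_top intro!: exI[of _ \<C>])
qed

text \<open>On \<open>G\<close> the local notions in the definition of \<open>Linf\<close> therefore reduce to the usual ones.\<close>

lemma (in sigma_finite_measure) locally_ae_iff_AE: "locally_ae M P \<longleftrightarrow> (AE x in M. P x)"
proof
  assume L: "locally_ae M P"
  obtain A :: "nat \<Rightarrow> 'a set" where A: "range A \<subseteq> sets M" "(\<Union>i. A i) = space M"
      "\<And>i. emeasure M (A i) \<noteq> \<infinity>"
    using sigma_finite by blast
  have "AE x in M. \<forall>i. x \<in> A i \<longrightarrow> P x"
    unfolding AE_all_countable
  proof
    fix i show "AE x in M. x \<in> A i \<longrightarrow> P x"
      using L A(1) A(3)[of i] unfolding locally_ae_def by (auto simp: less_top)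
  qed
  moreover have "AE x in M. x \<in> space M" by simp
  ultimately show "AE x in M. P x"
    by eventually_elim (use A(2) in blast)
qed (auto simp: locally_ae_def)

lemma (in sigma_finite_measure) locally_measurable_iff:
  "locally_measurable M f \<longleftrightarrow> f \<in> borel_measurable M"
proof
  assume L: "locally_measurable M f"
  obtain A :: "nat \<Rightarrow> 'a set" where A: "range A \<subseteq> sets M" "(\<Union>i. A i) = space M"
      "\<And>i. emeasure M (A i) \<noteq> \<infinity>"
    using sigma_finite by blast
  show "f \<in> borel_measurable M"
  proof (rule measurable_piecewise_restrict[of "range A"])
    fix B assume "B \<in> range A"
    then show "B \<inter> space M \<in> sets M" "f \<in> borel_measurable (restrict_space M B)"
      using A(1,3) L unfolding locally_measurable_def by (auto simp: less_top)
  qed (use A in auto)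
qed (auto simp: locally_measurable_def measurable_restrict_space1)

section \<open>Averaging over windows\<close>

text \<open>
  Where the window is empty or null, the value is \<open>0\<close> since division by zero yields zero. Thus the mean
  needs no case distinction outside the pieces of a decomposition and stays equivariant there.
\<close>

definition window_mean :: "'g measure \<Rightarrow> ('x \<Rightarrow> 'g set) \<Rightarrow> ('g \<Rightarrow> real) \<Rightarrow> 'x \<Rightarrow> real" where
  "window_mean \<nu> W f x = (LINT g:W x|\<nu>. f g) / measure \<nu> (W x)"

text \<open>This is the change of variables \<open>g \<mapsto> h\<inverse>g\<close>, which maps the window at \<open>x\<close> to the one at \<open>h\<inverse>x\<close>.\<close>

lemma window_mean_equivariant:
  fixes \<nu> :: "'g::topological_group_add measure"
  assumes sets: "sets \<nu> = sets borel" and inv: "invariant_measure (+) \<nu>"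
    and f: "f \<in> borel_measurable borel"
    and W: "\<And>x. W x \<in> sets borel" "\<And>h x g. g \<in> W (act h x) \<longleftrightarrow> - h + g \<in> W x"
  shows "window_mean \<nu> W (\<lambda>g. f (- h + g)) x = window_mean \<nu> W f (act (- h) x)"
proof -
  have [simp]: "space \<nu> = UNIV" using sets_eq_imp_space_eq[OF sets] by simp
  have cont: "continuous_on UNIV ((+) (- h))" by (intro continuous_intros)
  then have tr: "(+) (- h) \<in> measurable \<nu> borel"
    using borel_measurable_continuous_onI measurable_cong_sets[OF sets] by blast
  have mem: "g \<in> W x \<longleftrightarrow> - h + g \<in> W (act (- h) x)" for g
    using W(2)[of "- h + g" "- h" x] by (simp add: add.assoc[symmetric])
  have "(LINT g:W x|\<nu>. f (- h + g)) =
      (\<integral>g. indicator (W (act (- h) x)) (- h + g) *\<^sub>R f (- h + g) \<partial>\<nu>)"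
    unfolding set_lebesgue_integral_def
    by (intro Bochner_Integration.integral_cong) (auto simp: indicator_def mem)
  also have "\<dots> = (\<integral>g. indicator (W (act (- h) x)) g *\<^sub>R f g \<partial>distr \<nu> borel ((+) (- h)))"
    using f W(1)
    by (intro integral_distr[symmetric, OF tr] borel_measurable_scaleR borel_measurable_indicator)
  also have "\<dots> = (LINT g:W (act (- h) x)|\<nu>. f g)"
    using inv unfolding invariant_measure_def set_lebesgue_integral_def by simp
  finally have 1: "(LINT g:W x|\<nu>. f (- h + g)) = (LINT g:W (act (- h) x)|\<nu>. f g)" .
  have "W x = (+) (- h) -` W (act (- h) x)" using mem by auto
  then have "measure \<nu> (W x) = measure \<nu> (W (act (- h) x))"
    using emeasure_translate[OF inv sets cont W(1)] by (metis measure_def)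
  then show ?thesis using 1 by (simp add: window_mean_def)
qed

text \<open>
  By the measurability part of Fubini's theorem. The graph of the windows is required to be measurable
  only over sets of finite measure: over all of \<open>\<Omega>\<close> it may be an uncountable union.
\<close>

lemma window_mean_measurable:
  assumes sf: "sigma_finite_measure \<nu>" and sets: "sets \<nu> = sets borel" "sets \<mu> = sets borel"
    and f: "f \<in> borel_measurable borel"
    and W: "\<And>F. F \<in> sets borel \<Longrightarrow> emeasure \<mu> F < \<infinity> \<Longrightarrow>
              {(x, g). x \<in> F \<and> g \<in> W x} \<in> sets (borel \<Otimes>\<^sub>M borel)"
  shows "locally_measurable \<mu> (window_mean \<nu> W f)"
  unfolding locally_measurable_def
proof (intro ballI impI)
  interpret sigma_finite_measure \<nu> by fact
  fix F assume F: "F \<in> sets \<mu>" "emeasure \<mu> F < \<infinity>"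
  let ?S = "{(x, g). x \<in> F \<and> g \<in> W x}"
  have S [measurable]: "?S \<in> sets (\<mu> \<Otimes>\<^sub>M \<nu>)"
    using W[of F] F sets by (simp cong: sets_pair_measure_cong)
  have int: "(\<lambda>x. \<integral>g. indicator ?S (x, g) * k g \<partial>\<nu>) \<in> borel_measurable \<mu>"
    if "k \<in> borel_measurable borel" for k :: "_ \<Rightarrow> real"
  proof -
    have [measurable]: "k \<in> borel_measurable \<nu>"
      using that measurable_cong_sets[OF sets(1)] by blast
    show ?thesis by measurable
  qed
  have "(\<lambda>x. (\<integral>g. indicator ?S (x, g) * f g \<partial>\<nu>) / (\<integral>g. indicator ?S (x, g) * 1 \<partial>\<nu>))
      \<in> borel_measurable \<mu>"
    using int[OF f] int[of "\<lambda>_. 1"] by (intro borel_measurable_divide) auto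
  then have "(\<lambda>x. (\<integral>g. indicator ?S (x, g) * f g \<partial>\<nu>) / (\<integral>g. indicator ?S (x, g) * 1 \<partial>\<nu>))
      \<in> borel_measurable (restrict_space \<mu> F)"
    by (rule measurable_restrict_space1)
  moreover have "window_mean \<nu> W f x =
      (\<integral>g. indicator ?S (x, g) * f g \<partial>\<nu>) / (\<integral>g. indicator ?S (x, g) * 1 \<partial>\<nu>)"
    if "x \<in> F" for x
  proof -
    have "indicator ?S (x, g) = (indicator (W x) g :: real)" for g
      using that by (simp add: indicator_def)
    then show ?thesis
      using sets_eq_imp_space_eq[OF sets(1)]
      by (simp add: window_mean_def set_lebesgue_integral_def)
  qed
  ultimately show "window_mean \<nu> W f \<in> borel_measurable (restrict_space \<mu> F)"
    by (subst measurable_cong) (auto simp: space_restrict_space)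
qed

lemma window_mean_bounds:
  assumes "W x \<in> sets \<nu>" "emeasure \<nu> (W x) < \<infinity>" and f: "f \<in> borel_measurable \<nu>"
    and c: "AE g in \<nu>. \<bar>f g\<bar> \<le> c"
  shows "set_integrable \<nu> (W x) f" and "\<bar>window_mean \<nu> W f x\<bar> \<le> \<bar>c\<bar>"
proof -
  have c': "AE g in \<nu>. \<bar>f g\<bar> \<le> \<bar>c\<bar>" using c by eventually_elim auto
  have ind: "integrable \<nu> (\<lambda>g. \<bar>c\<bar> * indicator (W x) g)"
    using assms(1,2) by (simp add: less_top)
  show int: "set_integrable \<nu> (W x) f"
    unfolding set_integrable_def
  proof (rule Bochner_Integration.integrable_bound[OF ind])
    show "(\<lambda>g. indicator (W x) g *\<^sub>R f g) \<in> borel_measurable \<nu>"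
      using assms(1) f by measurable
    show "AE g in \<nu>. norm (indicator (W x) g *\<^sub>R f g) \<le> norm (\<bar>c\<bar> * indicator (W x) g)"
      using c' by eventually_elim (auto simp: indicator_def)
  qed
  have "\<bar>LINT g:W x|\<nu>. f g\<bar> \<le> (\<integral>g. \<bar>indicator (W x) g *\<^sub>R f g\<bar> \<partial>\<nu>)"
    unfolding set_lebesgue_integral_def by (rule integral_abs_bound)
  also have "\<dots> \<le> (\<integral>g. \<bar>c\<bar> * indicator (W x) g \<partial>\<nu>)"
  proof (rule integral_mono_AE[OF _ ind])
    show "integrable \<nu> (\<lambda>g. \<bar>indicator (W x) g *\<^sub>R f g\<bar>)"
      using int unfolding set_integrable_def by (rule integrable_abs)
    show "AE g in \<nu>. \<bar>indicator (W x) g *\<^sub>R f g\<bar> \<le> \<bar>c\<bar> * indicator (W x) g"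
      using c' by eventually_elim (auto simp: indicator_def)
  qed
  also have "\<dots> = \<bar>c\<bar> * measure \<nu> (W x)"
    using assms(1) sets.Int_space_eq2[of "W x" \<nu>] by simp
  finally have "\<bar>LINT g:W x|\<nu>. f g\<bar> \<le> \<bar>c\<bar> * measure \<nu> (W x)" .
  then show "\<bar>window_mean \<nu> W f x\<bar> \<le> \<bar>c\<bar>"
    by (cases "measure \<nu> (W x) = 0")
      (auto simp: window_mean_def abs_divide divide_le_eq zero_less_measure_iff)
qed

lemma amenable_via_windows:
  fixes \<nu> :: "'g::topological_group_add measure" and \<mu> :: "'x::topological_space measure"
  assumes sf: "sigma_finite_measure \<nu>" and sets: "sets \<nu> = sets borel" "sets \<mu> = sets borel"
    and inv: "invariant_measure (+) \<nu>"
    and W: "\<And>x. W x \<in> sets borel" "\<And>x. emeasure \<nu> (W x) < \<infinity>"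
      "\<And>h x g. g \<in> W (act h x) \<longleftrightarrow> - h + g \<in> W x"
    and W_meas: "\<And>F. F \<in> sets borel \<Longrightarrow> emeasure \<mu> F < \<infinity> \<Longrightarrow>
              {(x, g). x \<in> F \<and> g \<in> W x} \<in> sets (borel \<Otimes>\<^sub>M borel)"
    and W_pos: "locally_ae \<mu> (\<lambda>x. 0 < emeasure \<nu> (W x))"
    and M: "invariant_mean act \<mu> M"
  shows "amenable \<nu>"
proof -
  interpret sigma_finite_measure \<nu> by fact
  let ?\<Phi> = "window_mean \<nu> W"
  have meas_eq: "f \<in> borel_measurable \<nu> \<longleftrightarrow> f \<in> borel_measurable borel" for f :: "'g \<Rightarrow> real"
    using measurable_cong_sets[OF sets(1)] by blast
  have W': "W x \<in> sets \<nu>" for x using W(1) sets by simp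
  have Linf_\<nu>: "f \<in> Linf \<nu> \<longleftrightarrow> f \<in> borel_measurable borel \<and> (\<exists>c. AE g in \<nu>. \<bar>f g\<bar> \<le> c)" for f
    unfolding Linf_def by (simp add: locally_measurable_iff locally_ae_iff_AE meas_eq)
  have int: "set_integrable \<nu> (W x) f" if "f \<in> Linf \<nu>" for f x
    using that window_mean_bounds(1)[of W x \<nu> f] W' W(2)
    unfolding Linf_\<nu> meas_eq[symmetric] by blast
  have \<Phi>: "?\<Phi> f \<in> Linf \<mu>" if f: "f \<in> Linf \<nu>" for f
  proof -
    obtain c where c: "AE g in \<nu>. \<bar>f g\<bar> \<le> c" using f unfolding Linf_\<nu> by blast
    have "\<bar>?\<Phi> f x\<bar> \<le> \<bar>c\<bar>" for x
      using window_mean_bounds(2)[of W x \<nu> f c, OF W' W(2) _ c] f unfolding Linf_\<nu> meas_eq by blast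
    then have "locally_ae \<mu> (\<lambda>x. \<bar>?\<Phi> f x\<bar> \<le> \<bar>c\<bar>)" by (simp add: locally_ae_def)
    moreover have "locally_measurable \<mu> (?\<Phi> f)"
      using window_mean_measurable[OF sf sets _ W_meas] f unfolding Linf_\<nu> by blast
    ultimately show ?thesis unfolding Linf_def by blast
  qed
  have one: "(\<lambda>x. 1) \<in> Linf \<nu>" "(\<lambda>x. 1) \<in> Linf \<mu>"
    by (auto simp: Linf_def locally_measurable_def locally_ae_def intro!: exI[of _ 1])
  have \<Phi>_cong: "?\<Phi> f = ?\<Phi> h" if "AE g in \<nu>. f g = h g" "f \<in> Linf \<nu>" "h \<in> Linf \<nu>" for f h
  proof
    fix x
    have "(LINT g:W x|\<nu>. f g) = (LINT g:W x|\<nu>. h g)"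
      unfolding set_lebesgue_integral_def
      using that(1) int[OF that(2), of x] int[OF that(3), of x]
      unfolding set_integrable_def
      by (intro integral_cong_AE borel_measurable_integrable) auto
    then show "?\<Phi> f x = ?\<Phi> h x" by (simp add: window_mean_def)
  qed
  have \<Phi>_add: "?\<Phi> (\<lambda>g. f g + h g) = (\<lambda>x. ?\<Phi> f x + ?\<Phi> h x)" if "f \<in> Linf \<nu>" "h \<in> Linf \<nu>" for f h
    using set_integral_add(2)[OF int[OF that(1)] int[OF that(2)]]
    by (auto simp: window_mean_def add_divide_distrib)
  have \<Phi>_scale: "?\<Phi> (\<lambda>g. c * f g) = (\<lambda>x. c * ?\<Phi> f x)" for f c
    by (auto simp: window_mean_def)
  have \<Phi>_nonneg: "0 \<le> ?\<Phi> f x" if "AE g in \<nu>. 0 \<le> f g" for f x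
    unfolding window_mean_def set_lebesgue_integral_def
    using that by (intro divide_nonneg_nonneg integral_nonneg_AE) (auto elim!: eventually_mono)
  have \<Phi>_one_ae: "locally_ae \<mu> (\<lambda>x. ?\<Phi> (\<lambda>g. 1) x = 1)"
  proof -
    have "?\<Phi> (\<lambda>g. 1) x = 1" if "0 < emeasure \<nu> (W x)" for x
    proof -
      have "measure \<nu> (W x) \<noteq> 0"
        using that W(2)[of x] by (auto simp: measure_def enn2real_eq_0_iff)
      moreover have "(LINT g:W x|\<nu>. 1) = measure \<nu> (W x)"
        using W'[of x] sets.Int_space_eq2[of "W x" \<nu>] by (simp add: set_lebesgue_integral_def)
      ultimately show ?thesis by (simp add: window_mean_def)
    qed
    then show ?thesis using W_pos unfolding locally_ae_def by (auto elim!: eventually_mono)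
  qed
  have \<Phi>_one: "M (?\<Phi> (\<lambda>g. 1)) = 1"
  proof -
    have "M (?\<Phi> (\<lambda>g. 1)) = M (\<lambda>x. 1)"
      using M \<Phi>[OF one(1)] one(2) \<Phi>_one_ae
      unfolding invariant_mean_def by simp
    then show ?thesis using M unfolding invariant_mean_def by simp
  qed
  have "invariant_mean (+) \<nu> (\<lambda>f. M (?\<Phi> f))"
    unfolding invariant_mean_def
  proof (intro conjI ballI allI impI)
    fix f h assume "f \<in> Linf \<nu>" "h \<in> Linf \<nu>" "locally_ae \<nu> (\<lambda>x. f x = h x)"
    then show "M (?\<Phi> f) = M (?\<Phi> h)" using \<Phi>_cong locally_ae_iff_AE by metis
  next
    fix f h assume fh: "f \<in> Linf \<nu>" "h \<in> Linf \<nu>"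
    then show "M (?\<Phi> (\<lambda>x. f x + h x)) = M (?\<Phi> f) + M (?\<Phi> h)"
      using M \<Phi>[of f] \<Phi>[of h] unfolding \<Phi>_add[OF fh] invariant_mean_def by blast
  next
    fix f c assume "f \<in> Linf \<nu>"
    then show "M (?\<Phi> (\<lambda>x. c * f x)) = c * M (?\<Phi> f)"
      using M \<Phi>[of f] unfolding \<Phi>_scale invariant_mean_def by blast
  next
    fix f assume "f \<in> Linf \<nu>" and nonneg: "locally_ae \<nu> (\<lambda>x. 0 \<le> f x)"
    have "locally_ae \<mu> (\<lambda>x. 0 \<le> ?\<Phi> f x)"
      by (simp add: locally_ae_def \<Phi>_nonneg[OF nonneg[unfolded locally_ae_iff_AE]])
    then show "0 \<le> M (?\<Phi> f)"
      using M \<Phi>[OF \<open>f \<in> Linf \<nu>\<close>] unfolding invariant_mean_def by blast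
  next
    show "M (?\<Phi> (\<lambda>x. 1)) = 1" by (fact \<Phi>_one)
  next
    fix h f assume f: "f \<in> Linf \<nu>"
    have "?\<Phi> (\<lambda>x. f (- h + x)) = (\<lambda>x. ?\<Phi> f (act (- h) x))"
      using window_mean_equivariant[OF sets(1) inv _ W(1,3)] f unfolding Linf_\<nu> by blast
    then show "M (?\<Phi> (\<lambda>x. f (- h + x))) = M (?\<Phi> f)"
      using M \<Phi>[OF f] unfolding invariant_mean_def by simp
  qed
  then show ?thesis unfolding amenable_def by blast
qed

section \<open>Amenability of groups acting properly\<close>

theorem proposition1p1:
  fixes \<nu> :: "'g::{topological_group_add, t2_space, second_countable_topology} measure"
    and act :: "'g \<Rightarrow> 'x::t2_space \<Rightarrow> 'x"
    and \<mu> :: "'x measure"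
  assumes "locally_compact_space (euclidean :: 'g topology)"
    and "\<not> compact (UNIV :: 'g set)"
    and "left_haar_measure \<nu>"
    and "locally_compact_space (euclidean :: 'x topology)"
    and "proper_action act"
    and "regular_borel_measure \<mu>"
    and "invariant_measure act \<mu>"
    and "\<exists>M. invariant_mean act \<mu> M"
  shows "amenable \<nu>"
proof -
  note lc = assms(1) and haar = assms(3) and reg = assms(6) and inv = assms(7)
  note \<nu> = left_haar_measureD[OF haar]
  note act = proper_actionD(1)[OF assms(5)]
  note D = continuous_actionD[OF act]
  obtain \<K> where cpt: "\<And>K. K \<in> \<K> \<Longrightarrow> compact K"
    and disj: "disjoint_family_on (saturation act) \<K>"
    and count: "\<And>U. open U \<Longrightarrow> emeasure \<mu> U < \<infinity> \<Longrightarrow>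
           countable {K \<in> \<K>. saturation act K \<inter> U \<noteq> {}}"
    and null: "\<And>U. open U \<Longrightarrow> emeasure \<mu> U < \<infinity> \<Longrightarrow>
           U - (\<Union>K\<in>\<K>. saturation act K) \<in> null_sets \<mu>"
    using exists_charged_decomposition[OF lc act reg inv] by blast
  have "\<exists>V C. open V \<and> compact C \<and> K \<subseteq> V \<and> V \<subseteq> C" if "K \<in> \<K>" for K
    by (rule compact_subset_open_subset_compact[OF assms(4) cpt[OF that]]) blast
  then obtain V C where VC: "\<And>K. K \<in> \<K> \<Longrightarrow> open (V K)" "\<And>K. K \<in> \<K> \<Longrightarrow> compact (C K)"
      "\<And>K. K \<in> \<K> \<Longrightarrow> K \<subseteq> V K" "\<And>K. K \<in> \<K> \<Longrightarrow> V K \<subseteq> C K"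
    by metis
  \<comment> \<open>\<open>S K\<close> is the graph of the windows over the saturation of \<open>K\<close>, extended to all of \<open>\<Omega>\<close> so that it is open.
    The windows \<open>W x\<close> use the one member \<open>K\<close> of the family whose saturation contains \<open>x\<close>.\<close>
  define S where "S K = {(x, g). act (- g) x \<in> V K}" for K
  define W where "W x = {g. \<exists>K\<in>\<K>. x \<in> saturation act K \<and> act (- g) x \<in> V K}" for x
  have W_eq: "W x = {g. act (- g) x \<in> V K}" if "K \<in> \<K>" "x \<in> saturation act K" for x K
  proof -
    have "K' = K" if "K' \<in> \<K>" "x \<in> saturation act K'" for K'
      using disjoint_family_onD[OF disj that(1) \<open>K \<in> \<K>\<close>] that(2) \<open>x \<in> saturation act K\<close> by blast
    then show ?thesis using that unfolding W_def by blast
  qed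
  have W_empty: "W x = {}" if "x \<notin> (\<Union>K\<in>\<K>. saturation act K)" for x
    using that unfolding W_def by blast
  have S_open: "open (S K)" if "K \<in> \<K>" for K
  proof -
    have "continuous_on UNIV (\<lambda>(g, x). act g x)" using act unfolding continuous_action_def by blast
    then have "continuous_on UNIV ((\<lambda>(g, x). act g x) \<circ> (\<lambda>p :: 'x \<times> 'g. (- snd p, fst p)))"
      by (intro continuous_on_compose continuous_intros) (auto intro: continuous_on_subset)
    then have "open (((\<lambda>(g, x). act g x) \<circ> (\<lambda>p. (- snd p, fst p))) -` V K)"
      using VC(1)[OF that] by (simp add: open_vimage)
    also have "((\<lambda>(g, x). act g x) \<circ> (\<lambda>p. (- snd p, fst p))) -` V K = S K"
      unfolding S_def by auto
    finally show ?thesis .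
  qed
  have W_open: "open (W x)" for x
  proof (cases "x \<in> (\<Union>K\<in>\<K>. saturation act K)")
    case True
    then obtain K where K: "K \<in> \<K>" "x \<in> saturation act K" by blast
    have "open (Pair x -` S K)"
      by (intro open_vimage S_open K continuous_intros)
    then show ?thesis using W_eq[OF K] by (simp add: S_def vimage_def)
  qed (use W_empty in simp)
  have W_fin: "emeasure \<nu> (W x) < \<infinity>" for x
  proof (cases "x \<in> (\<Union>K\<in>\<K>. saturation act K)")
    case True
    then obtain K where K: "K \<in> \<K>" "x \<in> saturation act K" by blast
    let ?R = "closure {g. act g ` C K \<inter> {x} \<noteq> {}}"
    have "compact ?R"
      by (rule proper_actionD(2)[OF assms(5) VC(2)[OF K(1)] compact_sing])
    have "W x \<subseteq> ?R"
    proof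
      fix g assume "g \<in> W x"
      then have "act (- g) x \<in> C K" using W_eq[OF K] VC(4)[OF K(1)] by blast
      then have "x \<in> act g ` C K" using D(4)[of g x] by (metis imageI)
      then have "g \<in> {g. act g ` C K \<inter> {x} \<noteq> {}}" by blast
      then show "g \<in> ?R" by (rule closure_subset[THEN subsetD])
    qed
    then have "emeasure \<nu> (W x) \<le> emeasure \<nu> ?R"
      using regular_borel_measureD(1)[OF \<nu>(1)] by (intro emeasure_mono) auto
    then show ?thesis
      using regular_borel_measureD(3)[OF \<nu>(1) \<open>compact ?R\<close>] by simp
  qed (use W_empty in simp)
  have W_pos: "0 < emeasure \<nu> (W x)" if "x \<in> (\<Union>K\<in>\<K>. saturation act K)" for x
  proof -
    from that obtain K where K: "K \<in> \<K>" "x \<in> saturation act K" by blast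
    obtain g where "act (- g) x \<in> K" using K(2) unfolding mem_saturation_iff[OF act] ..
    then have "W x \<noteq> {}" using W_eq[OF K] VC(3)[OF K(1)] by blast
    then show ?thesis using haar_open_positive[OF haar W_open] by blast
  qed
  have W_equiv: "g \<in> W (act h x) \<longleftrightarrow> - h + g \<in> W x" for g h x
    unfolding W_def
    by (simp add: saturation_invariant[OF act] minus_add D(2))
  have W_meas: "{(x, g). x \<in> F \<and> g \<in> W x} \<in> sets (borel \<Otimes>\<^sub>M borel)"
    if F: "F \<in> sets borel" "emeasure \<mu> F < \<infinity>" for F
  proof -
    obtain U where U: "open U" "F \<subseteq> U" "emeasure \<mu> U < \<infinity>"
      by (rule regular_outer_open[OF reg F])
    let ?L = "{K \<in> \<K>. saturation act K \<inter> U \<noteq> {}}"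
    \<comment> \<open>Over \<open>F\<close> only countably many members of the family contribute to the graph.\<close>
    have "{(x, g). x \<in> F \<and> g \<in> W x} =
        (\<Union>K\<in>?L. ((F \<inter> saturation act K) \<times> UNIV) \<inter> S K)"
      using U(2) unfolding W_def S_def by blast
    moreover have "((F \<inter> saturation act K) \<times> UNIV) \<inter> S K \<in> sets (borel \<Otimes>\<^sub>M borel)"
      if "K \<in> ?L" for K
    proof (intro sets.Int pair_measureI)
      show "saturation act K \<in> sets borel" using that by (intro saturation_borel[OF lc act cpt]) auto
      show "S K \<in> sets (borel \<Otimes>\<^sub>M borel)" using that by (intro open_in_sets_borel_pair S_open) auto
    qed (use F in auto)
    ultimately show ?thesis using count[OF U(1,3)] by (simp only: sets.countable_UN'')
  qed
  have "locally_ae \<mu> (\<lambda>x. 0 < emeasure \<nu> (W x))"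
    unfolding locally_ae_def
  proof (intro ballI impI)
    fix F assume F: "F \<in> sets \<mu>" "emeasure \<mu> F < \<infinity>"
    then have "F \<in> sets borel" using regular_borel_measureD(1)[OF reg] by simp
    then obtain U where U: "open U" "F \<subseteq> U" "emeasure \<mu> U < \<infinity>"
      using F(2) by (rule regular_outer_open[OF reg])
    have "AE x in \<mu>. x \<notin> U - (\<Union>K\<in>\<K>. saturation act K)"
      by (rule AE_not_in[OF null[OF U(1,3)]])
    then show "AE x in \<mu>. x \<in> F \<longrightarrow> 0 < emeasure \<nu> (W x)"
      by eventually_elim (use U(2) W_pos in blast)
  qed
  moreover obtain M where "invariant_mean act \<mu> M" using assms(8) by blast
  ultimately show ?thesis
    by (intro amenable_via_windows[OF sigma_compact_imp_sigma_finite[OF lc \<nu>(1)]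
        regular_borel_measureD(1)[OF \<nu>(1)] regular_borel_measureD(1)[OF reg] \<nu>(3)
        borel_open[OF W_open] W_fin W_equiv W_meas])
qed

end
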